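(* Let $n\ge 2$ and let $a,b$ be integers with $1\le a\le n-1$ and $1\le b\le n-1$. Then \[ T(R_{n,a,b}) = \frac{T(R_{n-1,a,b-1})\,T(R_{n-1,a-1,b}) + T(R_{n-1,a,b})\,T(R_{n-1,a-1,b-1})}{T(R_{n-2,a-1,b-1})}. \]
   Context: For an integer $m\ge 0$, let $R_m$ be the bipartite graph with "white" vertices $w(i,j)$ for $0\le i,j\le m$ and "black" vertices $v(i,j)$ for $0\le i\le m-1$, $0\le j\le m+1$, where $v(i,j)$ is adjacent to $w(i',j')$ if and only if $i'\in\{i,i+1\}$ and $j'\in\{j-1,j\}$. (This is the dual graph of the Aztec rectangle whose boundary diagonals have lengths $m$ and $m+1$; geometrically, $w(i,j)$ sits at the point $(i,j+\tfrac12)$ and $v(i,j)$ at $(i+\tfrac12,j)$ in rotated coordinates.) For $0\le a,b\le m$, $R_{m,a,b}$ denotes the graph $R_m$ with the white vertex $w(b,a)$ deleted (the holey Aztec rectangle with the square labelled $(a,b)$ removed). For a graph $H$, $T(H)$ denotes the number of perfect matchings of $H$ (equal to the number of domino tilings of the corresponding region); the empty graph has one perfect matching. *)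

theory Defs
  imports Complex_Main
begin

text \<open>A graph is a pair of a vertex set and a set of two-element edges.\<close>

type_synonym 'a graph = "'a set \<times> 'a set set"

definition delete_vertex :: "'a graph \<Rightarrow> 'a \<Rightarrow> 'a graph" where
  "delete_vertex H x = (fst H - {x}, {e \<in> snd H. x \<notin> e})"

definition perfect_matching :: "'a graph \<Rightarrow> 'a set set \<Rightarrow> bool" where
  "perfect_matching H M \<longleftrightarrow>
     M \<subseteq> snd H \<and> (\<forall>x \<in> fst H. \<exists>!e. e \<in> M \<and> x \<in> e)"

definition T :: "'a graph \<Rightarrow> nat" where
  "T H = card {M. perfect_matching H M}"

datatype vertex = White nat nat | Black nat nat

definition aztec_vertices :: "nat \<Rightarrow> vertex set" where
  "aztec_vertices m =
     {White i j | i j. i \<le> m \<and> j \<le> m} \<union> {Black i j | i j. i < m \<and> j \<le> m + 1}"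

text \<open>The condition \<open>j' \<in> {j - 1, j}\<close> is written \<open>j' + 1 = j \<or> j' = j\<close>, because subtraction
  on naturals truncates at \<open>j = 0\<close>.\<close>

definition aztec_edges :: "nat \<Rightarrow> vertex set set" where
  "aztec_edges m =
     {{Black i j, White i' j'} | i j i' j'.
        i < m \<and> j \<le> m + 1 \<and> i' \<le> m \<and> j' \<le> m \<and>
        (i' = i \<or> i' = i + 1) \<and> (j' + 1 = j \<or> j' = j)}"

definition aztec_rectangle :: "nat \<Rightarrow> vertex graph" where
  "aztec_rectangle m = (aztec_vertices m, aztec_edges m)"

text \<open>The square labelled \<open>(a, b)\<close> is the white vertex with coordinates \<open>(b, a)\<close>, in this
  swapped order.\<close>

definition holey_aztec :: "nat \<Rightarrow> nat \<Rightarrow> nat \<Rightarrow> vertex graph" where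
  "holey_aztec m a b = delete_vertex (aztec_rectangle m) (White b a)"

end

theory Submission
  imports Defs "HOL-Analysis.Fashoda_Theorem"
begin

text \<open>
  This is Kuo's graphical condensation for \<open>R\<^sub>n\<close> with the hole, with the four boundary vertices
  \<open>w(0,0)\<close>, \<open>v(0,1)\<close>, \<open>w(0,n)\<close>, \<open>v(n-1,1)\<close>: deleting two or all four of them forces a boundary row and
  column to be matched in the only possible way, which leaves the smaller rectangles with the hole in
  its original place. Superpose a matching of the whole graph and one of the graph without the four
  vertices; swapping the two along the connected component of \<open>w(0,0)\<close> is an involution onto the pairs
  counted on the other side. A parity count of the two colours and planarity determine
  which of the four vertices the component contains. Planarity is used only in the form that
  disjoint lattice paths from bottom to top and from left to right do not exist, which is the
  Fashoda meet theorem for the drawing of the graph in the plane.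
\<close>

section \<open>Superposition of two matchings\<close>

text \<open>The edge set \<open>E\<close> stays ambient, so deleting vertices only changes
  \<open>V\<close>, and matchings of different subgraphs can be compared as sets of edges.\<close>

definition induced :: "'a set set \<Rightarrow> 'a set \<Rightarrow> 'a graph" where
  "induced E V = (V, {e \<in> E. e \<subseteq> V})"

lemma perfect_matching_induced:
  "perfect_matching (induced E V) M \<longleftrightarrow>
     M \<subseteq> E \<and> (\<forall>e\<in>M. e \<subseteq> V) \<and> (\<forall>x\<in>V. \<exists>!e. e \<in> M \<and> x \<in> e)"
  by (auto simp: perfect_matching_def induced_def)

lemma perfect_matching_induced_unique:
  assumes "perfect_matching (induced E V) M" "e \<in> M" "e' \<in> M" "x \<in> e" "x \<in> e'"
  shows "e = e'"
  using assms unfolding perfect_matching_induced by (metis in_mono)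

lemma perfect_matching_induced_Union:
  assumes "perfect_matching (induced E V) M"
  shows "\<Union>M = V"
  using assms unfolding perfect_matching_induced by auto

lemma finite_matchings:
  assumes "finite V"
  shows "finite {M. perfect_matching (induced E V) M}"
proof (rule finite_subset)
  show "{M. perfect_matching (induced E V) M} \<subseteq> Pow (Pow V)"
    by (auto simp: perfect_matching_induced)
qed (simp add: assms)

section \<open>Connected components of a set of edges\<close>

definition union_rel :: "'a set set \<Rightarrow> ('a \<times> 'a) set" where
  "union_rel M = {(x, y). {x, y} \<in> M}"

definition component :: "'a set set \<Rightarrow> 'a \<Rightarrow> 'a set" where
  "component M x = {y. (x, y) \<in> (union_rel M)\<^sup>*}"

lemma component_self [simp]: "x \<in> component M x"
  by (simp add: component_def)

lemma component_step: "\<lbrakk>y \<in> component M x; {y, z} \<in> M\<rbrakk> \<Longrightarrow> z \<in> component M x"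
  by (auto simp: component_def union_rel_def intro: rtrancl_into_rtrancl)

lemma sym_union_rel: "sym (union_rel M)"
  by (auto simp: sym_def union_rel_def insert_commute)

lemma component_disjoint:
  assumes "y \<notin> component M x"
  shows "component M x \<inter> component M y = {}"
proof -
  have "y \<in> component M x" if "z \<in> component M x" "z \<in> component M y" for z
    using that sym_rtrancl[OF sym_union_rel[of M]]
    by (auto simp: component_def dest: symD intro: rtrancl_trans)
  with assms show ?thesis by blast
qed

lemma component_subset:
  assumes "x \<in> V" "\<And>e. e \<in> M \<Longrightarrow> e \<subseteq> V"
  shows "component M x \<subseteq> V"
proof
  fix y assume "y \<in> component M x"
  then have "(x, y) \<in> (union_rel M)\<^sup>*" by (simp add: component_def)
  then show "y \<in> V"
    by induction (use assms in \<open>auto simp: union_rel_def\<close>)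
qed

text \<open>Every initial piece of a path from \<open>x\<close> ends in the component, so the path
  itself stays inside. This gives the connected sets to which planarity is applied later.\<close>

lemma component_connected:
  assumes "y \<in> component M x"
  shows "(x, y) \<in> {(u, v). u \<in> component M x \<and> v \<in> component M x \<and> {u, v} \<in> M}\<^sup>*"
proof -
  have "(x, y) \<in> (union_rel M)\<^sup>*" using assms by (simp add: component_def)
  then show ?thesis
  proof induction
    case (step y z)
    from step have "y \<in> component M x" "{y, z} \<in> M"
      by (simp_all add: component_def union_rel_def)
    then have "y \<in> component M x" "z \<in> component M x" "{y, z} \<in> M"
      using component_step by metis+
    with step.IH show ?case by (auto intro: rtrancl_into_rtrancl)
  qed auto
qed

text \<open>A connected graph on k vertices has at least k - 1 edges. Edges are counted here as
  ordered pairs, each of them twice, whence the bound 2k - 2.\<close>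

lemma component_edge_count:
  assumes fin: "finite (component M x)" and loopless: "\<And>y. {y} \<notin> M"
  shows "2 * card (component M x) \<le> card {(u, v). u \<in> component M x \<and> v \<in> component M x \<and> {u, v} \<in> M} + 2"
proof -
  define C where "C = component M x"
  define D where "D S = {(u, v). u \<in> S \<and> v \<in> S \<and> {u, v} \<in> M}" for S
  have finD: "finite (D S)" if "finite S" for S
    by (rule finite_subset[of _ "S \<times> S"]) (use that in \<open>auto simp: D_def\<close>)
  \<comment> \<open>Grow a subset from \<open>{x}\<close> one vertex at a time; each new vertex
    brings an edge to the old ones and hence at least two ordered pairs.\<close>
  have grow: "\<exists>S\<subseteq>C. x \<in> S \<and> card S = Suc k \<and> 2 * Suc k \<le> card (D S) + 2" if "Suc k \<le> card C" for k
    using that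
  proof (induction k)
    case 0
    show ?case by (rule exI[of _ "{x}"]) (simp add: C_def)
  next
    case (Suc k)
    then obtain S where S: "S \<subseteq> C" "x \<in> S" "card S = Suc k" "2 * Suc k \<le> card (D S) + 2"
      by auto
    have finS: "finite S" using S(1) fin C_def finite_subset by blast
    \<comment> \<open>If no edge left \<open>S\<close>, every path from \<open>x\<close> would stay
      in \<open>S\<close>, and \<open>S\<close> would be the whole component.\<close>
    have "\<exists>y\<in>S. \<exists>z\<in>C - S. {y, z} \<in> M"
    proof (rule ccontr)
      assume no: "\<not> ?thesis"
      have "C \<subseteq> S"
      proof
        fix y assume "y \<in> C"
        then have "(x, y) \<in> (union_rel M)\<^sup>*" by (simp add: C_def component_def)
        then show "y \<in> S"
        proof induction
          case (step y z)
          then have "{y, z} \<in> M" by (simp add: union_rel_def)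
          moreover from this have "z \<in> C"
            using component_step[of y M x z] step.IH S(1) by (auto simp: C_def)
          ultimately show ?case using no step.IH by auto
        qed (use S in auto)
      qed
      with S(1,3) Suc.prems show False by simp
    qed
    then obtain y z where yz: "y \<in> S" "z \<in> C" "z \<notin> S" "{y, z} \<in> M" by auto
    have sub: "D S \<union> {(y, z), (z, y)} \<subseteq> D (insert z S)"
      using yz by (auto simp: D_def insert_commute)
    have "y \<noteq> z" using yz by auto
    then have "card {(y, z), (z, y)} = 2" by simp
    moreover have "D S \<inter> {(y, z), (z, y)} = {}" using yz by (auto simp: D_def)
    ultimately have "card (D S) + 2 = card (D S \<union> {(y, z), (z, y)})"
      using card_Un_disjoint[OF finD[OF finS], of "{(y, z), (z, y)}"] by (metis finite.emptyI finite.insertI)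
    also have "\<dots> \<le> card (D (insert z S))"
      using sub finD finS by (intro card_mono) auto
    finally have "card (D S) + 2 \<le> card (D (insert z S))" .
    then show ?case
      using S yz finS by (intro exI[of _ "insert z S"]) auto
  qed
  have "C \<noteq> {}" by (auto simp: C_def component_def)
  then have "card C > 0" using fin by (simp add: C_def card_gt_0_iff)
  then obtain S where S: "S \<subseteq> C" "card S = card C" "2 * card C \<le> card (D S) + 2"
    using grow[of "card C - 1"] by auto
  then have "S = C" using fin C_def card_subset_eq by blast
  with S show ?thesis by (simp add: C_def D_def)
qed

section \<open>Exchanging two matchings inside a set of vertices\<close>

definition swap_in :: "'a set \<Rightarrow> 'a set set \<Rightarrow> 'a set set \<Rightarrow> 'a set set" where
  "swap_in C M N = {e \<in> M. \<not> e \<subseteq> C} \<union> {e \<in> N. e \<subseteq> C}"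

definition swap_pair :: "'a \<Rightarrow> 'a set set \<times> 'a set set \<Rightarrow> 'a set set \<times> 'a set set" where
  "swap_pair x = (\<lambda>(M, N). let C = component (M \<union> N) x in (swap_in C M N, swap_in C N M))"

lemma swap_in_union: "swap_in C M N \<union> swap_in C N M = M \<union> N"
  by (auto simp: swap_in_def)

lemma swap_in_twice: "swap_in C (swap_in C M N) (swap_in C N M) = M"
  by (auto simp: swap_in_def)

text \<open>A swap preserves \<open>M \<union> N\<close> and therefore the component along which it
  is made, so the second swap undoes the first.\<close>

lemma swap_pair_swap_pair: "swap_pair x (swap_pair x p) = p"
  by (cases p) (simp add: swap_pair_def Let_def swap_in_union swap_in_twice)

text \<open>No edge crosses the boundary of \<open>C\<close>, so the edges kept from
  \<open>M\<close> cover exactly \<open>U - C\<close> and those taken from \<open>N\<close> cover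
  exactly \<open>V \<inter> C\<close>.\<close>

lemma perfect_matching_swap_in:
  assumes M: "perfect_matching (induced E U) M" and N: "perfect_matching (induced E V) N"
    and closed: "\<And>e. e \<in> M \<union> N \<Longrightarrow> e \<subseteq> C \<or> e \<inter> C = {}"
    and V': "V' = (U - C) \<union> (V \<inter> C)"
  shows "perfect_matching (induced E V') (swap_in C M N)"
  unfolding perfect_matching_induced
proof (intro conjI ballI)
  show "swap_in C M N \<subseteq> E"
    using M N by (auto simp: swap_in_def perfect_matching_induced)
  show "e \<subseteq> V'" if e: "e \<in> swap_in C M N" for e
  proof -
    consider "e \<in> M" "\<not> e \<subseteq> C" | "e \<in> N" "e \<subseteq> C"
      using e unfolding swap_in_def by blast
    then show ?thesis
    proof cases
      case 1
      then have "e \<inter> C = {}" "e \<subseteq> U"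
        using closed[of e] M by (auto simp: perfect_matching_induced)
      then show ?thesis using V' by blast
    next
      case 2
      then have "e \<subseteq> V" using N by (auto simp: perfect_matching_induced)
      then show ?thesis using V' 2 by blast
    qed
  qed
  fix x assume "x \<in> V'"
  then consider "x \<in> U" "x \<notin> C" | "x \<in> V" "x \<in> C" using V' by blast
  then show "\<exists>!e. e \<in> swap_in C M N \<and> x \<in> e"
  proof cases
    case 1
    then have "\<exists>!e. e \<in> M \<and> x \<in> e" using M by (simp add: perfect_matching_induced)
    moreover have "e \<in> swap_in C M N \<and> x \<in> e \<longleftrightarrow> e \<in> M \<and> x \<in> e" for e
      using 1 by (auto simp: swap_in_def)
    ultimately show ?thesis by simp
  next
    case 2
    then have "\<exists>!e. e \<in> N \<and> x \<in> e" using N by (simp add: perfect_matching_induced)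
    moreover have "e \<in> swap_in C M N \<and> x \<in> e \<longleftrightarrow> e \<in> N \<and> x \<in> e" for e
      using 2 closed[of e] by (auto simp: swap_in_def)
    ultimately show ?thesis by simp
  qed
qed

section \<open>Colour balance of matched sets\<close>

definition imbalance :: "('a \<Rightarrow> bool) \<Rightarrow> 'a set \<Rightarrow> int" where
  "imbalance w S = (\<Sum>x\<in>S. if w x then 1 else - 1)"

text \<open>The matched edges inside \<open>C\<close> partition \<open>C \<inter> V\<close>, and
  each of them contributes one vertex of either colour.\<close>

lemma imbalance_matching:
  assumes M: "perfect_matching (induced E V) M" and finV: "finite V"
    and bip: "\<And>e. e \<in> E \<Longrightarrow> \<exists>x y. e = {x, y} \<and> w x \<and> \<not> w y"
    and closed: "\<And>e. e \<in> M \<Longrightarrow> e \<subseteq> C \<or> e \<inter> C = {}"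
  shows "imbalance w (C \<inter> V) = 0"
proof -
  define MC where "MC = {e \<in> M. e \<subseteq> C}"
  have MV: "\<Union>M = V" by (rule perfect_matching_induced_Union[OF M])
  have un: "C \<inter> V = \<Union>MC"
    using closed unfolding MC_def MV[symmetric] by blast
  have ME: "M \<subseteq> E" using M by (simp add: perfect_matching_induced)
  have fin: "finite e" if "e \<in> MC" for e
  proof (rule finite_subset[OF _ finV])
    show "e \<subseteq> V" using that MV by (auto simp: MC_def)
  qed
  have "imbalance w (C \<inter> V) = (\<Sum>e\<in>MC. imbalance w e)"
    unfolding imbalance_def un
  proof (rule sum.Union_disjoint[unfolded comp_def])
    show "\<forall>e\<in>MC. finite e" using fin by blast
    show "\<forall>A\<in>MC. \<forall>B\<in>MC. A \<noteq> B \<longrightarrow> A \<inter> B = {}"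
      using perfect_matching_induced_unique[OF M] unfolding MC_def by blast
  qed
  also have "\<dots> = 0"
  proof (rule sum.neutral, rule ballI)
    fix e assume "e \<in> MC"
    then have "e \<in> E" using ME by (auto simp: MC_def)
    then obtain x y where "e = {x, y}" "w x" "\<not> w y" using bip by blast
    moreover from this have "x \<noteq> y" by auto
    ultimately show "imbalance w e = 0" by (simp add: imbalance_def)
  qed
  finally show ?thesis .
qed

section \<open>Graphical condensation\<close>

definition edges_within :: "'a set set \<Rightarrow> 'a set \<Rightarrow> ('a \<times> 'a) set" where
  "edges_within E A = {(x, y). x \<in> A \<and> y \<in> A \<and> {x, y} \<in> E}"

text \<open>The assumption \<open>no_crossing\<close> stands for planarity: it holds when
  \<open>a\<close>, \<open>b\<close>, \<open>c\<close>, \<open>d\<close> lie in this cyclic order on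
  the outer face of a plane graph. The colours alternate along that order.\<close>

locale condensation =
  fixes E :: "'a set set" and V :: "'a set" and w :: "'a \<Rightarrow> bool" and a b c d :: 'a
  assumes finite_V: "finite V"
    and bipartite: "\<And>e. e \<in> E \<Longrightarrow> \<exists>x y. e = {x, y} \<and> w x \<and> \<not> w y"
    and corners: "a \<in> V" "b \<in> V" "c \<in> V" "d \<in> V"
    and colours: "w a" "\<not> w b" "w c" "\<not> w d"
    and distinct_corners: "a \<noteq> c" "b \<noteq> d"
    and no_crossing: "\<And>A B. \<lbrakk>A \<subseteq> V; B \<subseteq> V; A \<inter> B = {}; (a, c) \<in> (edges_within E A)\<^sup>*;
      (b, d) \<in> (edges_within E B)\<^sup>*\<rbrakk> \<Longrightarrow> False"
begin

lemma no_loops: "{x} \<notin> E"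
  using bipartite by fastforce

text \<open>Exchanging \<open>b\<close> and \<open>d\<close> only reverses the second path in
  \<open>no_crossing\<close>. Every result about the split \<open>{a, b}\<close>,
  \<open>{c, d}\<close> thus also covers \<open>{a, d}\<close>, \<open>{b, c}\<close>.\<close>

lemma flip: "condensation E V w a d c b"
proof
  fix A B assume "A \<subseteq> V" "B \<subseteq> V" "A \<inter> B = {}" "(a, c) \<in> (edges_within E A)\<^sup>*"
    and db: "(d, b) \<in> (edges_within E B)\<^sup>*"
  moreover have "sym (edges_within E B)"
    by (auto simp: sym_def edges_within_def insert_commute)
  then have "(b, d) \<in> (edges_within E B)\<^sup>*" using db sym_rtrancl by (metis symD)
  ultimately show False using no_crossing by blast
qed (use finite_V bipartite corners colours distinct_corners in auto)

section \<open>Superposing two matchings that miss given vertices\<close>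

abbreviation matchings :: "'a set \<Rightarrow> 'a set set set" where
  "matchings X \<equiv> {M. perfect_matching (induced E (V - X)) M}"

context
  fixes X Y :: "'a set" and M N :: "'a set set"
  assumes M: "M \<in> matchings X" and N: "N \<in> matchings Y"
begin

lemma superposition_subset: "e \<in> M \<union> N \<Longrightarrow> e \<in> E" "e \<in> M \<union> N \<Longrightarrow> e \<subseteq> V"
  using M N by (auto simp: perfect_matching_induced)

lemma component_closed:
  assumes "e \<in> M \<union> N"
  shows "e \<subseteq> component (M \<union> N) x \<or> e \<inter> component (M \<union> N) x = {}"
proof -
  obtain y z where e: "e = {y, z}" using superposition_subset(1)[OF assms] bipartite by blast
  have "y \<in> component (M \<union> N) x \<longleftrightarrow> z \<in> component (M \<union> N) x"
    using component_step[of y "M \<union> N" x z] component_step[of z "M \<union> N" x y] assms e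
    by (auto simp: insert_commute)
  then show ?thesis using e by blast
qed

lemma component_in_V: "x \<in> V \<Longrightarrow> component (M \<union> N) x \<subseteq> V"
  using component_subset superposition_subset(2) by metis

lemma component_connection:
  assumes "x \<in> V" "y \<in> component (M \<union> N) x"
  shows "(x, y) \<in> (edges_within E (component (M \<union> N) x))\<^sup>*"
proof (rule subsetD[OF rtrancl_mono component_connected[OF assms(2)]])
  show "{(u, v). u \<in> component (M \<union> N) x \<and> v \<in> component (M \<union> N) x \<and> {u, v} \<in> M \<union> N}
      \<subseteq> edges_within E (component (M \<union> N) x)"
    using superposition_subset(1) by (auto simp: edges_within_def)
qed

text \<open>\<open>M\<close> matches \<open>C - X\<close> within itself, so that part is balanced
  and the whole imbalance of \<open>C\<close> sits in the deleted vertices \<open>X\<close>; the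
  same holds for \<open>N\<close> and \<open>Y\<close>.\<close>

lemma component_imbalance:
  assumes "x \<in> V"
  defines "C \<equiv> component (M \<union> N) x"
  shows "imbalance w C = imbalance w (C \<inter> X)" "imbalance w C = imbalance w (C \<inter> Y)"
proof -
  have CV: "C \<subseteq> V" unfolding C_def by (rule component_in_V[OF assms(1)])
  then have finC: "finite C" using finite_V finite_subset by blast
  have split: "imbalance w C = imbalance w (C \<inter> Z) + imbalance w (C - Z)" for Z
    unfolding imbalance_def by (rule sum.Int_Diff[OF finC])
  have zero: "imbalance w (C - Z) = 0" if L: "L \<in> matchings Z" "L \<subseteq> M \<union> N" for L Z
  proof -
    have "C - Z = C \<inter> (V - Z)" using CV by auto
    moreover have "imbalance w (C \<inter> (V - Z)) = 0"
    proof (rule imbalance_matching)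
      show "perfect_matching (induced E (V - Z)) L" using L by simp
      show "e \<subseteq> C \<or> e \<inter> C = {}" if "e \<in> L" for e
        unfolding C_def using component_closed L that by blast
    qed (use finite_V bipartite in auto)
    ultimately show ?thesis by simp
  qed
  show "imbalance w C = imbalance w (C \<inter> X)" "imbalance w C = imbalance w (C \<inter> Y)"
    using split[of X] split[of Y] zero[OF M] zero[OF N] by auto
qed

text \<open>The component is a connected graph with vertex degrees at most 2 in which the four corners
  have degree at most 1, so it has too few edges to contain all of them.\<close>

lemma component_not_all_corners:
  assumes "{a, b, c, d} \<subseteq> X \<union> Y"
  shows "\<not> {a, b, c, d} \<subseteq> component (M \<union> N) a"
proof
  define C where "C = component (M \<union> N) a"
  assume "{a, b, c, d} \<subseteq> component (M \<union> N) a"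
  then have sub: "{a, b, c, d} \<subseteq> C" by (simp add: C_def)
  have CV: "C \<subseteq> V" unfolding C_def by (rule component_in_V[OF corners(1)])
  then have finC: "finite C" using finite_V finite_subset by blast
  define nb where "nb L x = {y \<in> C. {x, y} \<in> L}" for L x
  have nb_le: "card (nb L x) \<le> of_bool (x \<notin> Z)" if L: "L \<in> matchings Z" for L Z x
  proof (cases "x \<in> Z")
    case True
    then have "nb L x = {}" using L by (auto simp: nb_def perfect_matching_induced)
    then show ?thesis using True by simp
  next
    case False
    have "y = z" if "y \<in> nb L x" "z \<in> nb L x" for y z
    proof -
      have "{x, y} = {x, z}"
        using perfect_matching_induced_unique[of E "V - Z" L "{x, y}" "{x, z}" x] L that
        by (auto simp: nb_def)
      then show ?thesis by (auto simp: doubleton_eq_iff)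
    qed
    then have "card (nb L x) \<le> 1" by (simp add: card_le_Suc0_iff_eq finC nb_def)
    then show ?thesis using False by simp
  qed
  have "2 * card C \<le> card {(u, v). u \<in> C \<and> v \<in> C \<and> {u, v} \<in> M \<union> N} + 2"
    unfolding C_def
  proof (rule component_edge_count)
    show "finite (component (M \<union> N) a)" using finC C_def by simp
    show "{y} \<notin> M \<union> N" for y using superposition_subset(1) no_loops by blast
  qed
  also have "{(u, v). u \<in> C \<and> v \<in> C \<and> {u, v} \<in> M \<union> N} = Sigma C (nb (M \<union> N))"
    by (auto simp: nb_def)
  also have "card \<dots> = (\<Sum>x\<in>C. card (nb (M \<union> N) x))"
    by (rule card_SigmaI) (simp_all add: finC nb_def)
  finally have 1: "2 * card C \<le> (\<Sum>x\<in>C. card (nb (M \<union> N) x)) + 2" .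
  \<comment> \<open>Each matching gives a vertex at most one neighbour, and a corner is deleted for
    at least one of the two. Summing over \<open>C\<close>, the four corners lower the degree bound
    by 4, while connectedness allows a loss of only 2.\<close>
  have "card (nb (M \<union> N) x) + of_bool (x \<in> {a, b, c, d}) \<le> 2" for x
  proof -
    have "nb (M \<union> N) x = nb M x \<union> nb N x" by (auto simp: nb_def)
    then have "card (nb (M \<union> N) x) \<le> card (nb M x) + card (nb N x)"
      by (simp add: card_Un_le)
    with nb_le[OF M, of x] nb_le[OF N, of x] assms show ?thesis
      by (auto simp: of_bool_def split: if_splits)
  qed
  then have "(\<Sum>x\<in>C. card (nb (M \<union> N) x) + of_bool (x \<in> {a, b, c, d})) \<le> (\<Sum>x\<in>C. 2)"
    by (intro sum_mono) auto
  moreover have "(\<Sum>x\<in>C. of_bool (x \<in> Q)) = card (C \<inter> Q)" for Q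
    using finC by (simp add: of_bool_def flip: sum.inter_restrict)
  moreover have "C \<inter> {a, b, c, d} = {a, b, c, d}" using sub by blast
  moreover have "card {a, b, c, d} = 4"
    using colours distinct_corners by (auto simp: card_insert_if)
  ultimately have "(\<Sum>x\<in>C. card (nb (M \<union> N) x)) + 4 \<le> 2 * card C"
    by (simp add: sum.distrib del: insert_iff)
  with 1 show False by simp
qed

text \<open>Swapping along the component also exchanges the deleted vertices that lie in it: the
  part \<open>Z\<close> of \<open>X\<close> and \<open>Y\<close> inside the component changes sides,
  the rest stays.\<close>

lemma swap_matchings:
  assumes "swap_pair a (M, N) = (M', N')"
    and "component (M \<union> N) a \<inter> (X \<union> Y) = Z"
    and "X' = (X - Z) \<union> (Y \<inter> Z)" and "Y' = (Y - Z) \<union> (X \<inter> Z)"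
  shows "M' \<in> matchings X'" "N' \<in> matchings Y'"
proof -
  define C where "C = component (M \<union> N) a"
  have CV: "C \<subseteq> V" unfolding C_def by (rule component_in_V[OF corners(1)])
  have M': "M' = swap_in C M N" and N': "N' = swap_in C N M"
    using assms(1) by (simp_all add: swap_pair_def C_def Let_def)
  show "M' \<in> matchings X'"
    unfolding M' mem_Collect_eq
  proof (rule perfect_matching_swap_in)
    show "V - X' = (V - X - C) \<union> ((V - Y) \<inter> C)"
      using assms(2,3) CV unfolding C_def by blast
  qed (use M N component_closed C_def in auto)
  show "N' \<in> matchings Y'"
    unfolding N' mem_Collect_eq
  proof (rule perfect_matching_swap_in)
    show "V - Y' = (V - Y - C) \<union> ((V - X) \<inter> C)"
      using assms(2,4) CV unfolding C_def by blast
  qed (use M N component_closed C_def in auto)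
qed

end

section \<open>Which corners the component of \<open>a\<close> contains\<close>

lemma corners_distinct: "a \<noteq> b" "a \<noteq> d" "b \<noteq> c" "c \<noteq> d"
  using colours by auto

lemma imbalance_corners:
  "imbalance w (C \<inter> {a, b}) = of_bool (a \<in> C) - of_bool (b \<in> C)"
  "imbalance w (C \<inter> {c, d}) = of_bool (c \<in> C) - of_bool (d \<in> C)"
  "imbalance w (C \<inter> {a, b, c, d}) =
     of_bool (a \<in> C) - of_bool (b \<in> C) + of_bool (c \<in> C) - of_bool (d \<in> C)"
proof -
  have "imbalance w (C \<inter> Z) = (\<Sum>x\<in>Z. if x \<in> C then if w x then 1 else - 1 else 0)"
    if "finite Z" for Z
    unfolding imbalance_def by (subst Int_commute) (rule sum.inter_restrict[OF that])
  then show
    "imbalance w (C \<inter> {a, b}) = of_bool (a \<in> C) - of_bool (b \<in> C)"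
    "imbalance w (C \<inter> {c, d}) = of_bool (c \<in> C) - of_bool (d \<in> C)"
    "imbalance w (C \<inter> {a, b, c, d}) =
       of_bool (a \<in> C) - of_bool (b \<in> C) + of_bool (c \<in> C) - of_bool (d \<in> C)"
    using colours distinct_corners corners_distinct by simp_all
qed

text \<open>\<open>M\<close> deletes nothing, so the component is balanced, and so are the corners
  in it. It contains \<open>a\<close> but not all four corners; hence \<open>c\<close> is absent and
  exactly one of \<open>b\<close>, \<open>d\<close> is present.\<close>

lemma component_corners_full:
  assumes "M \<in> matchings {}" "N \<in> matchings {a, b, c, d}"
  shows "component (M \<union> N) a \<inter> {a, b, c, d} \<in> {{a, b}, {a, d}}"
proof -
  let ?C = "component (M \<union> N) a"
  have "imbalance w (?C \<inter> {a, b, c, d}) = 0"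
    using component_imbalance[OF assms corners(1)] by (simp add: imbalance_def)
  then have "(1::int) - of_bool (b \<in> ?C) + of_bool (c \<in> ?C) - of_bool (d \<in> ?C) = 0"
    unfolding imbalance_corners by simp
  moreover have "\<not> (b \<in> ?C \<and> c \<in> ?C \<and> d \<in> ?C)"
    using component_not_all_corners[OF assms] by simp
  ultimately have "c \<notin> ?C" "b \<in> ?C \<longleftrightarrow> d \<notin> ?C"
    by (auto simp: of_bool_def split: if_splits)
  then show ?thesis using component_self[of a "M \<union> N"]
    by (cases "b \<in> ?C") auto
qed

text \<open>The component has equal imbalance on \<open>{a, b}\<close> and on \<open>{c, d}\<close>.
  If it contains \<open>b\<close>, it contains both or neither of \<open>c\<close>,
  \<open>d\<close>, and the edge count excludes both. If it missed \<open>b\<close>, it would have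
  to join \<open>a\<close> to \<open>c\<close>.\<close>

lemma component_corners_split:
  assumes "M \<in> matchings {a, b}" "N \<in> matchings {c, d}"
  shows "component (M \<union> N) a \<inter> {a, b, c, d} = {a, b}"
proof -
  let ?C = "component (M \<union> N) a" and ?D = "component (M \<union> N) b"
  have all: "\<not> (b \<in> ?C \<and> c \<in> ?C \<and> d \<in> ?C)"
    using component_not_all_corners[OF assms] by simp
  have imb: "imbalance w (component (M \<union> N) x \<inter> {a, b}) = imbalance w (component (M \<union> N) x \<inter> {c, d})"
    if "x \<in> V" for x
    using component_imbalance[OF assms that] by simp
  note imb' = imb[unfolded imbalance_corners]
  have "b \<in> ?C"
  proof (rule ccontr)
    assume b: "b \<notin> ?C"
    then have c: "c \<in> ?C"
      using imb'[OF corners(1)] by (simp add: of_bool_def split: if_splits)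
    have disj: "?C \<inter> ?D = {}" using component_disjoint[OF b] .
    \<comment> \<open>The same balance equation for the component of \<open>b\<close> now forces
      \<open>d\<close> into it. Two disjoint connected sets then join opposite corners, which
      planarity forbids.\<close>
    then have "a \<notin> ?D" "c \<notin> ?D" using c component_self[of a "M \<union> N"] by blast+
    then have d: "d \<in> ?D"
      using imb'[OF corners(2)] by (simp add: of_bool_def split: if_splits)
    show False
      using no_crossing[of ?C ?D] component_in_V[OF assms] corners disj
        component_connection[OF assms corners(1) c] component_connection[OF assms corners(2) d]
      by blast
  qed
  moreover from this have "c \<notin> ?C" "d \<notin> ?C"
    using imb'[OF corners(1)] all by (auto simp: of_bool_def split: if_splits)
  ultimately show ?thesis by auto
qed

lemma swap_full:
  assumes "M \<in> matchings {}" "N \<in> matchings {a, b, c, d}"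
  shows "swap_pair a (M, N) \<in> matchings {a, b} \<times> matchings {c, d} \<union> matchings {a, d} \<times> matchings {b, c}"
proof -
  obtain M' N' where eq: "swap_pair a (M, N) = (M', N')" by fastforce
  consider "component (M \<union> N) a \<inter> {a, b, c, d} = {a, b}"
    | "component (M \<union> N) a \<inter> {a, b, c, d} = {a, d}"
    using component_corners_full[OF assms] by auto
  then show ?thesis
  proof cases
    case 1
    then have "M' \<in> matchings {a, b}" "N' \<in> matchings {c, d}"
      by (intro swap_matchings[OF assms eq, where Z = "{a, b}"];
          use corners_distinct distinct_corners in auto)+
    then show ?thesis using eq by auto
  next
    case 2
    then have "M' \<in> matchings {a, d}" "N' \<in> matchings {b, c}"
      by (intro swap_matchings[OF assms eq, where Z = "{a, d}"];
          use corners_distinct distinct_corners in auto)+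
    then show ?thesis using eq by auto
  qed
qed

lemma swap_split:
  assumes "M \<in> matchings {a, b}" "N \<in> matchings {c, d}"
  shows "swap_pair a (M, N) \<in> matchings {} \<times> matchings {a, b, c, d}"
proof -
  obtain M' N' where eq: "swap_pair a (M, N) = (M', N')" by fastforce
  have "M' \<in> matchings {}" "N' \<in> matchings {a, b, c, d}"
    by (intro swap_matchings[OF assms eq, where Z = "{a, b}"];
        use corners_distinct distinct_corners component_corners_split[OF assms] in auto)+
  then show ?thesis using eq by auto
qed

text \<open>The involution \<open>swap_pair a\<close> maps the pairs counted on the left into those
  counted on the right and conversely, so it is a bijection between them.\<close>

theorem graphical_condensation:
  "T (induced E V) * T (induced E (V - {a, b, c, d})) =
     T (induced E (V - {a, b})) * T (induced E (V - {c, d}))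
     + T (induced E (V - {a, d})) * T (induced E (V - {b, c}))"
proof -
  interpret flipped: condensation E V w a d c b by (rule flip)
  define P where "P = matchings {} \<times> matchings {a, b, c, d}"
  define Q where "Q = matchings {a, b} \<times> matchings {c, d}"
  define R where "R = matchings {a, d} \<times> matchings {b, c}"
  have "swap_pair a ` P \<subseteq> Q \<union> R"
    unfolding P_def Q_def R_def using swap_full by blast
  moreover have "swap_pair a ` Q \<subseteq> P"
    unfolding P_def Q_def using swap_split by blast
  moreover have "swap_pair a ` R \<subseteq> P"
  proof -
    have "{a, d, c, b} = {a, b, c, d}" "{c, b} = {b, c}" by auto
    then show ?thesis unfolding P_def R_def using flipped.swap_split by (metis (no_types) SigmaE image_subsetI)
  qed
  ultimately have "bij_betw (swap_pair a) P (Q \<union> R)"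
    by (intro bij_betw_byWitness[where f' = "swap_pair a"]) (auto simp: swap_pair_swap_pair)
  then have card: "card P = card (Q \<union> R)" by (rule bij_betw_same_card)
  have fin: "finite (matchings Z)" for Z
    by (rule finite_matchings) (simp add: finite_V)
  \<comment> \<open>The vertices covered by the first matching of a pair reveal whether
    \<open>b\<close> or \<open>d\<close> was deleted.\<close>
  have "Q \<inter> R = {}"
  proof -
    have False if "M \<in> matchings {a, b}" "M \<in> matchings {a, d}" for M
    proof -
      have "V - {a, b} = V - {a, d}"
        using that perfect_matching_induced_Union by (metis mem_Collect_eq)
      then show False using corners distinct_corners colours by blast
    qed
    then show ?thesis unfolding Q_def R_def by blast
  qed
  with card have "card P = card Q + card R"
    using fin by (simp add: card_Un_disjoint Q_def R_def)
  then show ?thesis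
    by (simp add: P_def Q_def R_def T_def card_cartesian_product)
qed

end

section \<open>Crossing paths in the lattice\<close>

text \<open>The adjacency of the rectangles without their bounds. All of them become induced
  subgraphs of one infinite graph.\<close>

definition lattice_edges :: "vertex set set" where
  "lattice_edges = {{Black i j, White i' j'} | i j i' j'.
     (i' = i \<or> i' = i + 1) \<and> (j' + 1 = j \<or> j' = j)}"

text \<open>Twice the geometric coordinates, which keeps everything integral: white vertices have
  even abscissa and odd ordinate, black ones the opposite, and edges are diagonals of unit
  squares.\<close>

fun position :: "vertex \<Rightarrow> real^2" where
  "position (White i j) = vector [2 * real i, 2 * real j + 1]"
| "position (Black i j) = vector [2 * real i + 1, 2 * real j]"

definition drawing :: "vertex set \<Rightarrow> (real^2) set" where
  "drawing A = \<Union>{closed_segment (position x) (position y) | x y.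
     x \<in> A \<and> y \<in> A \<and> {x, y} \<in> lattice_edges}"

text \<open>A point of an edge is parametrised from its white end: \<open>l\<close> runs from 0 at
  the white vertex to 1 at the black one, and \<open>(s, t)\<close> is the diagonal
  direction.\<close>

lemma drawing_pointE:
  assumes "z \<in> drawing A"
  obtains i j p q l s t where
    "Black i j \<in> A" "White p q \<in> A" "0 \<le> l" "l \<le> 1" "s \<in> {- 1, 1}" "t \<in> {- 1, 1}"
    "2 * real i + 1 = 2 * real p + s" "2 * real j = 2 * real q + 1 + t"
    "z $ 1 = 2 * real p + l * s" "z $ 2 = 2 * real q + 1 + l * t"
proof -
  obtain x y where xy: "x \<in> A" "y \<in> A" "{x, y} \<in> lattice_edges"
    and z: "z \<in> closed_segment (position x) (position y)"
    using assms by (auto simp: drawing_def)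
  obtain i j p q where e: "{x, y} = {Black i j, White p q}"
    and adj: "p = i \<or> p = i + 1" "q + 1 = j \<or> q = j"
    using xy(3) by (auto simp: lattice_edges_def)
  have "z \<in> closed_segment (position (White p q)) (position (Black i j))"
    using z e by (auto simp: doubleton_eq_iff closed_segment_commute)
  then obtain l where l: "0 \<le> l" "l \<le> 1"
    and zl: "z = (1 - l) *\<^sub>R position (White p q) + l *\<^sub>R position (Black i j)"
    by (auto simp: in_segment)
  show thesis
  proof (rule that)
    show "Black i j \<in> A" "White p q \<in> A" using xy e by (auto simp: doubleton_eq_iff)
    show "z $ 1 = 2 * real p + l * (2 * real i + 1 - 2 * real p)"
      "z $ 2 = 2 * real q + 1 + l * (2 * real j - 2 * real q - 1)"
      by (simp_all add: zl algebra_simps)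
  qed (use l adj in auto)
qed

text \<open>At a common point with \<open>l = l' = 1\<close> the two black ends coincide. Otherwise
  the white ends differ by less than 2 in each coordinate; white vertices are spaced by 2, so they
  coincide. Either way \<open>A\<close> and \<open>B\<close> share a vertex.\<close>

lemma drawing_disjoint:
  assumes "A \<inter> B = {}"
  shows "drawing A \<inter> drawing B = {}"
proof -
  have False if "z \<in> drawing A" "z \<in> drawing B" for z
  proof -
    from that(1) obtain i j p q l s t where A:
      "Black i j \<in> A" "White p q \<in> A" "0 \<le> l" "l \<le> 1" "s \<in> {- 1, 1}" "t \<in> {- 1, 1}"
      "2 * real i + 1 = 2 * real p + s" "2 * real j = 2 * real q + 1 + t"
      "z $ 1 = 2 * real p + l * s" "z $ 2 = 2 * real q + 1 + l * t"
      by (rule drawing_pointE)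
    from that(2) obtain i' j' p' q' l' s' t' where B:
      "Black i' j' \<in> B" "White p' q' \<in> B" "0 \<le> l'" "l' \<le> 1" "s' \<in> {- 1, 1}" "t' \<in> {- 1, 1}"
      "2 * real i' + 1 = 2 * real p' + s'" "2 * real j' = 2 * real q' + 1 + t'"
      "z $ 1 = 2 * real p' + l' * s'" "z $ 2 = 2 * real q' + 1 + l' * t'"
      by (rule drawing_pointE)
    show False
    proof (cases "l = 1 \<and> l' = 1")
      case True
      then have "i = i'" "j = j'" using A B by auto
      with A(1) B(1) assms show False by auto
    next
      case False
      then have "l + l' < 2" using A(4) B(4) by linarith
      moreover have "\<bar>l * s\<bar> \<le> l" "\<bar>l * t\<bar> \<le> l" "\<bar>l' * s'\<bar> \<le> l'" "\<bar>l' * t'\<bar> \<le> l'"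
        using A B by auto
      ultimately have "\<bar>real p - real p'\<bar> < 1" "\<bar>real q - real q'\<bar> < 1"
        using A(9,10) B(9,10) by linarith+
      then have "p = p'" "q = q'" by linarith+
      with A(2) B(2) assms show False by auto
    qed
  qed
  then show ?thesis by blast
qed

lemma path_component_drawing:
  assumes "(x, y) \<in> (edges_within lattice_edges A)\<^sup>*" "position x \<in> S" "drawing A \<subseteq> S"
  shows "path_component S (position x) (position y)"
  using assms(1)
proof induction
  case base
  show ?case using assms(2) by (simp add: path_component_refl)
next
  case (step y z)
  then have "closed_segment (position y) (position z) \<subseteq> S"
    using assms(3) by (auto simp: drawing_def edges_within_def)
  then have "path_component S (position y) (position z)"
    unfolding path_component_def by (intro exI[of _ "linepath (position y) (position z)"]) auto
  with step.IH show ?case by (rule path_component_trans)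
qed

lemma drawing_subset_cbox:
  assumes "A \<subseteq> aztec_vertices n"
  shows "drawing A \<subseteq> cbox 0 (vector [2 * real n, 2 * real n + 2])"
proof
  fix z assume "z \<in> drawing A"
  then obtain x y where xy: "x \<in> A" "y \<in> A" and z: "z \<in> closed_segment (position x) (position y)"
    by (auto simp: drawing_def)
  have "position v \<in> cbox 0 (vector [2 * real n, 2 * real n + 2])" if "v \<in> A" for v
    using that assms by (cases v) (auto simp: aztec_vertices_def mem_box_cart forall_2)
  then have "closed_segment (position x) (position y) \<subseteq> cbox 0 (vector [2 * real n, 2 * real n + 2])"
    using xy by (intro closed_segment_subset convex_box) auto
  with z show "z \<in> cbox 0 (vector [2 * real n, 2 * real n + 2])" by blast
qed

lemma edges_within_rtrancl_mem:
  assumes "(x, y) \<in> (edges_within E A)\<^sup>*" "x \<noteq> y"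
  shows "x \<in> A" "y \<in> A"
proof -
  show "x \<in> A" using assms by (cases rule: converse_rtranclE) (auto simp: edges_within_def)
  show "y \<in> A" using assms by (cases rule: rtranclE) (auto simp: edges_within_def)
qed

section \<open>Boundary segments and the crossing argument\<close>

definition vertical :: "real \<Rightarrow> real \<Rightarrow> real \<Rightarrow> (real^2) set" where
  "vertical x y y' = closed_segment (vector [x, y]) (vector [x, y'])"

definition horizontal :: "real \<Rightarrow> real \<Rightarrow> real \<Rightarrow> (real^2) set" where
  "horizontal x x' y = closed_segment (vector [x, y]) (vector [x', y])"

lemma vertical_pointD:
  assumes "z \<in> vertical x y y'" "y \<le> y'"
  shows "z $ 1 = x" "y \<le> z $ 2" "z $ 2 \<le> y'"
proof -
  obtain u where u: "0 \<le> u" "u \<le> 1" "z = (1 - u) *\<^sub>R vector [x, y] + u *\<^sub>R vector [x, y']"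
    using assms(1) by (auto simp: vertical_def in_segment)
  have "z $ 2 = y + u * (y' - y)" unfolding u(3) by (simp add: algebra_simps)
  moreover have "0 \<le> u * (y' - y)" "u * (y' - y) \<le> y' - y"
    using u assms(2) by (auto intro: mult_left_le_one_le)
  ultimately show "y \<le> z $ 2" "z $ 2 \<le> y'" by auto
  show "z $ 1 = x" unfolding u(3) by (simp add: algebra_simps)
qed

lemma horizontal_pointD:
  assumes "z \<in> horizontal x x' y" "x \<le> x'"
  shows "z $ 2 = y" "x \<le> z $ 1" "z $ 1 \<le> x'"
proof -
  obtain u where u: "0 \<le> u" "u \<le> 1" "z = (1 - u) *\<^sub>R vector [x, y] + u *\<^sub>R vector [x', y]"
    using assms(1) by (auto simp: horizontal_def in_segment)
  have "z $ 1 = x + u * (x' - x)" unfolding u(3) by (simp add: algebra_simps)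
  moreover have "0 \<le> u * (x' - x)" "u * (x' - x) \<le> x' - x"
    using u assms(2) by (auto intro: mult_left_le_one_le)
  ultimately show "x \<le> z $ 1" "z $ 1 \<le> x'" by auto
  show "z $ 2 = y" unfolding u(3) by (simp add: algebra_simps)
qed

text \<open>The abscissa on an edge is \<open>2 * p\<close> plus or minus \<open>l\<close> with
  \<open>l\<close> at most 1, so it is even only at the white end.\<close>

lemma drawing_even_abscissa:
  assumes "z \<in> drawing A" "z $ 1 = 2 * real i"
  obtains q where "White i q \<in> A" "z $ 2 = 2 * real q + 1"
  using assms(1)
proof (rule drawing_pointE)
  fix i' j p q l s t
  assume *: "White p q \<in> A" "0 \<le> l" "l \<le> 1" "s \<in> {- 1, 1}"
    "z $ 1 = 2 * real p + l * s" "z $ 2 = 2 * real q + 1 + l * t"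
  then have "\<bar>l * s\<bar> \<le> 1" by auto
  then have "\<bar>real p - real i\<bar> < 1" using *(5) assms(2) by linarith
  then have p: "p = i" by linarith
  then have "l = 0" using * assms(2) by auto
  then show thesis using that[of q] * p by simp
qed

lemma drawing_even_ordinate:
  assumes "z \<in> drawing A" "z $ 2 = 2 * real j"
  obtains i where "Black i j \<in> A" "z $ 1 = 2 * real i + 1"
  using assms(1)
proof (rule drawing_pointE)
  fix i j' p q l s t
  assume *: "Black i j' \<in> A" "0 \<le> l" "l \<le> 1" "t \<in> {- 1, 1}"
    "2 * real i + 1 = 2 * real p + s" "2 * real j' = 2 * real q + 1 + t"
    "z $ 1 = 2 * real p + l * s" "z $ 2 = 2 * real q + 1 + l * t"
  \<comment> \<open>On an even ordinate \<open>l * t\<close> is an odd integer of absolute value at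
    most 1, which leaves only the black end \<open>l = 1\<close>.\<close>
  have lt: "l * t = real_of_int (2 * int j - 2 * int q - 1)" using *(8) assms(2) by simp
  have "\<bar>l * t\<bar> = l" using * by auto
  moreover have "\<bar>2 * int j - 2 * int q - 1\<bar> \<ge> 1" by presburger
  ultimately have "l = 1" using lt \<open>l \<le> 1\<close> by linarith
  then have "j' = j" using * assms(2) by simp
  then show thesis using that[of i] * \<open>l = 1\<close> by simp
qed

text \<open>The Fashoda theorem needs curves that reach opposite sides of the box, but the end
  vertices lie at distance 1 from the sides. Each path is therefore extended by a unit segment at
  both ends, and the extensions must be shown to create no new intersection.\<close>

lemma lattice_crossing:
  assumes A: "A \<subseteq> aztec_vertices n" and B: "B \<subseteq> aztec_vertices n" and disj: "A \<inter> B = {}"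
    and ac: "(White i 0, White i' n) \<in> (edges_within lattice_edges A)\<^sup>*"
    and bd: "(Black 0 j, Black (n - 1) j') \<in> (edges_within lattice_edges B)\<^sup>*"
    and n: "n \<ge> 2" and j: "1 \<le> j" "j \<le> n" "1 \<le> j'" "j' \<le> n"
  shows False
proof -
  have mem: "White i 0 \<in> A" "White i' n \<in> A" "Black 0 j \<in> B" "Black (n - 1) j' \<in> B"
    using edges_within_rtrancl_mem[OF ac] edges_within_rtrancl_mem[OF bd] n by auto
  have ibound: "i \<le> n" "i' \<le> n" using mem A by (auto simp: aztec_vertices_def)
  let ?box = "cbox 0 (vector [2 * real n, 2 * real n + 2]) :: (real^2) set"
  define a1 where "a1 = vertical (2 * real i) 0 1"
  define c1 where "c1 = vertical (2 * real i') (2 * real n + 1) (2 * real n + 2)"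
  define b1 where "b1 = horizontal 0 1 (2 * real j)"
  define d1 where "d1 = horizontal (2 * real n - 1) (2 * real n) (2 * real j')"
  define SA where "SA = a1 \<union> drawing A \<union> c1"
  define SB where "SB = b1 \<union> drawing B \<union> d1"
  have seg: "path_component S x y" if "closed_segment x y \<subseteq> S" for S and x y :: "real^2"
    unfolding path_component_def by (intro exI[of _ "linepath x y"]) (use that in auto)
  note path_component_trans [trans]
  note ends = a1_def b1_def c1_def d1_def vertical_def horizontal_def
  have "path_component SA (vector [2 * real i, 0]) (position (White i 0))"
    by (rule seg) (auto simp: SA_def ends)
  also have "path_component SA \<dots> (position (White i' n))"
    by (rule path_component_drawing[OF ac]) (auto simp: SA_def ends)
  also have "path_component SA \<dots> (vector [2 * real i', 2 * real n + 2])"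
    by (rule seg) (auto simp: SA_def ends)
  finally obtain g where g: "path g" "path_image g \<subseteq> SA"
    "pathstart g = vector [2 * real i, 0]" "pathfinish g = vector [2 * real i', 2 * real n + 2]"
    unfolding path_component_def by blast
  have "path_component SB (vector [0, 2 * real j]) (position (Black 0 j))"
    by (rule seg) (auto simp: SB_def ends)
  also have "path_component SB \<dots> (position (Black (n - 1) j'))"
    by (rule path_component_drawing[OF bd]) (auto simp: SB_def ends)
  also have "path_component SB \<dots> (vector [2 * real n, 2 * real j'])"
    by (rule seg) (use n in \<open>auto simp: SB_def ends of_nat_diff algebra_simps\<close>)
  finally obtain f where f: "path f" "path_image f \<subseteq> SB"
    "pathstart f = vector [0, 2 * real j]" "pathfinish f = vector [2 * real n, 2 * real j']"
    unfolding path_component_def by blast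
  have "a1 \<subseteq> ?box" "b1 \<subseteq> ?box" "c1 \<subseteq> ?box" "d1 \<subseteq> ?box"
    unfolding ends by (intro closed_segment_subset convex_box;
        use ibound j n in \<open>auto simp: mem_box_cart forall_2\<close>)+
  then have box: "SA \<subseteq> ?box" "SB \<subseteq> ?box"
    using drawing_subset_cbox[OF A] drawing_subset_cbox[OF B] unfolding SA_def SB_def by blast+
  obtain z where "z \<in> path_image f" "z \<in> path_image g"
  proof (rule fashoda[of f g 0 "vector [2 * real n, 2 * real n + 2]"])
    show "path_image f \<subseteq> ?box" "path_image g \<subseteq> ?box" using f g box by auto
  qed (use f g in simp_all)
  then have z: "z \<in> SA" "z \<in> SB" using f g by auto
  have za: "z $ 1 = 2 * real i \<and> z $ 2 \<le> 1" if "z \<in> a1"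
    using vertical_pointD[OF that[unfolded a1_def]] by simp
  have zc: "z $ 1 = 2 * real i' \<and> 2 * real n + 1 \<le> z $ 2" if "z \<in> c1"
    using vertical_pointD[OF that[unfolded c1_def]] by simp
  have zb: "z $ 2 = 2 * real j \<and> z $ 1 \<le> 1" if "z \<in> b1"
    using horizontal_pointD[OF that[unfolded b1_def]] by simp
  have zd: "z $ 2 = 2 * real j' \<and> 2 * real n - 1 \<le> z $ 1 \<and> z $ 1 \<le> 2 * real n" if "z \<in> d1"
    using horizontal_pointD[OF that[unfolded d1_def]] by simp
  consider "z \<in> drawing A" "z \<in> drawing B" | "z \<in> a1 \<union> c1" "z \<in> b1 \<union> d1"
    | "z \<in> a1 \<union> c1" "z \<in> drawing B" | "z \<in> b1 \<union> d1" "z \<in> drawing A"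
    using z unfolding SA_def SB_def by blast
  then show False
  proof cases
    case 1
    then show False using drawing_disjoint[OF disj] by blast
  next
    case 2
    \<comment> \<open>The vertical segments have ordinate at most 1 or at least
      \<open>2 * n + 1\<close>, while the horizontal ones lie at \<open>2 * j\<close> and
      \<open>2 * j'\<close>, strictly in between.\<close>
    then show False using za zb zc zd j by auto
  next
    case 3
    from 3(1) show False
    proof
      assume "z \<in> a1"
      \<comment> \<open>The segment has even abscissa, so it can meet the drawing of
        \<open>B\<close> only at a white vertex. The height leaves only \<open>White i 0\<close>,
        which belongs to \<open>A\<close>.\<close>
      with za obtain q where "White i q \<in> B" "2 * real q + 1 \<le> 1"
        using drawing_even_abscissa[OF 3(2), of i] by metis
      then show False using mem disj by auto
    next
      assume "z \<in> c1"
      with zc obtain q where q: "White i' q \<in> B" "2 * real n + 1 \<le> 2 * real q + 1"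
        using drawing_even_abscissa[OF 3(2), of i'] by metis
      moreover have "q \<le> n" using q(1) B by (auto simp: aztec_vertices_def)
      ultimately show False using mem disj by auto
    qed
  next
    case 4
    from 4(1) show False
    proof
      assume "z \<in> b1"
      with zb obtain p where "Black p j \<in> A" "2 * real p + 1 \<le> 1"
        using drawing_even_ordinate[OF 4(2), of j] by metis
      then show False using mem disj by auto
    next
      assume "z \<in> d1"
      with zd obtain p where p: "Black p j' \<in> A" "2 * real n - 1 \<le> 2 * real p + 1"
        using drawing_even_ordinate[OF 4(2), of j'] by metis
      moreover have "p < n" using p(1) A by (auto simp: aztec_vertices_def)
      ultimately have "p = n - 1" by linarith
      then show False using p mem disj by auto
    qed
  qed
qed

section \<open>Forced edges\<close>

lemma perfect_matching_insert_edge: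
  assumes M: "perfect_matching (induced E (V - e)) M" and e: "e \<in> E" "e \<subseteq> V"
  shows "perfect_matching (induced E V) (insert e M)"
  unfolding perfect_matching_induced
proof (intro conjI ballI)
  fix x assume "x \<in> V"
  have disj: "x \<notin> e" if "e' \<in> M" "x \<in> e'" for e'
    using M that by (auto simp: perfect_matching_induced)
  show "\<exists>!e'. e' \<in> insert e M \<and> x \<in> e'"
  proof (cases "x \<in> e")
    case True
    with disj show ?thesis by blast
  next
    case False
    with \<open>x \<in> V\<close> M have "\<exists>!e'. e' \<in> M \<and> x \<in> e'" by (simp add: perfect_matching_induced)
    moreover have "e' \<in> insert e M \<and> x \<in> e' \<longleftrightarrow> e' \<in> M \<and> x \<in> e'" for e'
      using False by auto
    ultimately show ?thesis by simp
  qed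
qed (use assms in \<open>auto simp: perfect_matching_induced\<close>)

lemma perfect_matching_remove_edge:
  assumes M: "perfect_matching (induced E V) M" and e: "e \<in> M"
  shows "perfect_matching (induced E (V - e)) (M - {e})"
  unfolding perfect_matching_induced
proof (intro conjI ballI)
  have "e' \<inter> e = {}" if "e' \<in> M - {e}" for e'
    using perfect_matching_induced_unique[OF M, of e' e] that e by blast
  then show "e' \<subseteq> V - e" if "e' \<in> M - {e}" for e'
    using perfect_matching_induced_Union[OF M] that by fast
  fix x assume x: "x \<in> V - e"
  then have "\<exists>!e'. e' \<in> M \<and> x \<in> e'" using M by (simp add: perfect_matching_induced)
  moreover have "e' \<in> M - {e} \<and> x \<in> e' \<longleftrightarrow> e' \<in> M \<and> x \<in> e'" for e'
    using x by auto
  ultimately show "\<exists>!e'. e' \<in> M - {e} \<and> x \<in> e'" by simp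
qed (use M in \<open>auto simp: perfect_matching_induced\<close>)

text \<open>The vertex \<open>x\<close> can only be matched by \<open>e\<close>, so removing
  \<open>e\<close> from a matching and inserting it again are mutually inverse.\<close>

lemma T_forced_edge:
  assumes e: "e \<in> E" "e \<subseteq> V" "x \<in> e"
    and forced: "\<And>e'. \<lbrakk>e' \<in> E; e' \<subseteq> V; x \<in> e'\<rbrakk> \<Longrightarrow> e' = e"
  shows "T (induced E V) = T (induced E (V - e))"
proof -
  have "bij_betw (insert e) {M. perfect_matching (induced E (V - e)) M} {M. perfect_matching (induced E V) M}"
  proof (rule bij_betw_byWitness[where f' = "\<lambda>M. M - {e}"])
    have e_mem: "e \<in> M" if M: "perfect_matching (induced E V) M" for M
    proof -
      obtain e' where "e' \<in> M" "x \<in> e'"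
        using M e unfolding perfect_matching_induced by blast
      moreover from this have "e' = e"
        using M by (intro forced) (auto simp: perfect_matching_induced)
      ultimately show ?thesis by simp
    qed
    show "\<forall>M\<in>{M. perfect_matching (induced E (V - e)) M}. insert e M - {e} = M"
      using e(3) by (auto simp: perfect_matching_induced)
    show "\<forall>M\<in>{M. perfect_matching (induced E V) M}. insert e (M - {e}) = M"
      using e_mem by auto
    show "insert e ` {M. perfect_matching (induced E (V - e)) M} \<subseteq> {M. perfect_matching (induced E V) M}"
      using perfect_matching_insert_edge[OF _ e(1,2)] by auto
    show "(\<lambda>M. M - {e}) ` {M. perfect_matching (induced E V) M} \<subseteq> {M. perfect_matching (induced E (V - e)) M}"
      by (auto intro!: perfect_matching_remove_edge e_mem)
  qed
  from bij_betw_same_card[OF this] show ?thesis by (simp add: T_def)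
qed

lemma T_nonzero_extend:
  assumes "finite V" "e \<in> E" "e \<subseteq> V" "T (induced E (V - e)) \<noteq> 0"
  shows "T (induced E V) \<noteq> 0"
proof -
  obtain M where "perfect_matching (induced E (V - e)) M"
    using assms(4) by (auto simp: T_def card_eq_0_iff)
  then have "insert e M \<in> {M. perfect_matching (induced E V) M}"
    using perfect_matching_insert_edge assms by blast
  then show ?thesis
    using finite_matchings[OF assms(1)] unfolding T_def card_eq_0_iff by blast
qed

text \<open>The missing vertex \<open>p r\<close> makes the rest of the chain \<open>p lo, q lo, p (lo + 1), \<dots>, p hi\<close>
  collapse: matched edges are forced successively outwards from \<open>r\<close>.\<close>

lemma T_forced_chain:
  fixes p q :: "nat \<Rightarrow> 'a"
  assumes r: "lo \<le> r" "r \<le> hi" "p r \<notin> V"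
    and p: "\<And>t. \<lbrakk>lo \<le> t; t \<le> hi; t \<noteq> r\<rbrakk> \<Longrightarrow> p t \<in> V"
    and q: "\<And>t. \<lbrakk>lo \<le> t; t < hi\<rbrakk> \<Longrightarrow> q t \<in> V"
    and adj: "\<And>t. \<lbrakk>lo \<le> t; t < hi\<rbrakk> \<Longrightarrow> {q t, p t} \<in> E \<and> {q t, p (Suc t)} \<in> E"
    and only: "\<And>t e. \<lbrakk>lo \<le> t; t < hi; e \<in> E; e \<subseteq> V; q t \<in> e\<rbrakk> \<Longrightarrow> e = {q t, p t} \<or> e = {q t, p (Suc t)}"
    and inj: "inj p" "inj q" "range p \<inter> range q = {}"
  shows "T (induced E V) = T (induced E (V - p ` {lo..hi} - q ` {lo..<hi}))"
proof -
  have pq: "p s \<noteq> q t" "q t \<noteq> p s" for s t using inj(3) by (metis IntI emptyE rangeI)+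
  have pp: "p s = p t \<longleftrightarrow> s = t" and qq: "q s = q t \<longleftrightarrow> s = t" for s t
    using inj by (auto dest: injD)
  let ?W = "\<lambda>l u. V - p ` {l..u} - q ` {l..<u}"
  \<comment> \<open>Upward half: once everything from \<open>p r\<close> to \<open>p u\<close> is
    gone, the only partner left for \<open>q u\<close> is \<open>p (Suc u)\<close>.\<close>
  have up: "T (induced E V) = T (induced E (?W r u))" if "r \<le> u" "u \<le> hi" for u
    using that
  proof (induction u rule: dec_induct)
    case base
    show ?case using r by simp
  next
    case (step u)
    have "T (induced E (?W r u)) = T (induced E (?W r u - {q u, p (Suc u)}))"
    proof (rule T_forced_edge[where x = "q u"])
      show "{q u, p (Suc u)} \<in> E" using adj r step by simp
      show "{q u, p (Suc u)} \<subseteq> ?W r u" using p q r step pp pq qq by auto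
      fix e assume e: "e \<in> E" "e \<subseteq> ?W r u" "q u \<in> e"
      then have "e = {q u, p u} \<or> e = {q u, p (Suc u)}"
        using only[of u e] r step by auto
      moreover have "p u \<notin> e" using e(2) step by auto
      ultimately show "e = {q u, p (Suc u)}" by blast
    qed simp
    also have "?W r u - {q u, p (Suc u)} = ?W r (Suc u)"
      using step by (auto simp: atLeastAtMostSuc_conv atLeastLessThanSuc)
    finally show ?case using step by simp
  qed
  \<comment> \<open>Downward half: starting from the finished upper half, \<open>q l\<close> has
    lost \<open>p (Suc l)\<close> and must be matched with \<open>p l\<close>.\<close>
  have "T (induced E V) = T (induced E (?W l hi))" if "lo \<le> l" "l \<le> r" for l
    using that(2,1)
  proof (induction l rule: inc_induct)
    case base
    show ?case using up[of hi] r by simp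
  next
    case (step l)
    have ins: "{l..hi} = insert l {Suc l..hi}" "{l..<hi} = insert l {Suc l..<hi}"
      using step r by auto
    have "T (induced E (?W (Suc l) hi)) = T (induced E (?W (Suc l) hi - {q l, p l}))"
    proof (rule T_forced_edge[where x = "q l"])
      show "{q l, p l} \<in> E" using adj r step by simp
      show "{q l, p l} \<subseteq> ?W (Suc l) hi" using p q r step pp pq qq by auto
      fix e assume e: "e \<in> E" "e \<subseteq> ?W (Suc l) hi" "q l \<in> e"
      then have "e = {q l, p l} \<or> e = {q l, p (Suc l)}"
        using only[of l e] r step by auto
      moreover have "p (Suc l) \<notin> e" using e(2) step r by auto
      ultimately show "e = {q l, p l}" by blast
    qed simp
    also have "?W (Suc l) hi - {q l, p l} = ?W l hi"
      unfolding ins by auto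
    finally show ?case using step by simp
  qed
  from this[OF order_refl r(1)] show ?thesis .
qed

text \<open>Taking images and preimages of edges under \<open>f\<close> gives mutually inverse maps
  between the matchings, because \<open>f\<close> preserves and reflects edges. It is applied to
  translations.\<close>

lemma T_image:
  assumes inj: "inj f" and E: "\<And>e. f ` e \<in> E \<longleftrightarrow> e \<in> E"
  shows "T (induced E (f ` V)) = T (induced E V)"
proof -
  have pre: "f -` (f ` e) = e" for e using inj by (simp add: inj_vimage_image_eq)
  have post: "f ` (f -` e) = e" if "e \<subseteq> f ` V" for e using that by auto
  have "bij_betw ((`) ((`) f)) {M. perfect_matching (induced E V) M}
          {M. perfect_matching (induced E (f ` V)) M}"
  proof (rule bij_betw_byWitness[where f' = "(`) ((-`) f)"])
    show "\<forall>M\<in>{M. perfect_matching (induced E V) M}. (-`) f ` (`) f ` M = M"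
      by (simp add: image_image pre)
    show "\<forall>M\<in>{M. perfect_matching (induced E (f ` V)) M}. (`) f ` (-`) f ` M = M"
    proof safe
      fix M e assume M: "perfect_matching (induced E (f ` V)) M" and "e \<in> M"
      then have e: "f ` (f -` e) = e" by (intro post) (auto simp: perfect_matching_induced)
      show "f ` (f -` e) \<in> M" unfolding e by fact
      show "e \<in> (`) f ` (-`) f ` M" using e \<open>e \<in> M\<close> by (metis image_eqI)
    qed
    show "(`) ((`) f) ` {M. perfect_matching (induced E V) M} \<subseteq> {M. perfect_matching (induced E (f ` V)) M}"
    proof safe
      fix M assume M: "perfect_matching (induced E V) M"
      show "perfect_matching (induced E (f ` V)) ((`) f ` M)"
        unfolding perfect_matching_induced
      proof (intro conjI ballI)
        show "(`) f ` M \<subseteq> E" using M E by (auto simp: perfect_matching_induced)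
        show "e \<subseteq> f ` V" if "e \<in> (`) f ` M" for e
          using that M by (auto simp: perfect_matching_induced)
        fix y assume "y \<in> f ` V"
        then obtain x where x: "x \<in> V" "y = f x" by blast
        then obtain e where e: "e \<in> M" "x \<in> e" "\<And>e'. e' \<in> M \<Longrightarrow> x \<in> e' \<Longrightarrow> e' = e"
          using M unfolding perfect_matching_induced by metis
        show "\<exists>!e. e \<in> (`) f ` M \<and> y \<in> e"
        proof (rule ex1I[of _ "f ` e"])
          fix e' assume "e' \<in> (`) f ` M \<and> y \<in> e'"
          then obtain e1 where e1: "e1 \<in> M" "e' = f ` e1" "y \<in> e'" by auto
          then have "x \<in> e1" using x(2) inj_image_mem_iff[OF inj] by simp
          then show "e' = f ` e" using e(3)[OF e1(1)] e1(2) by simp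
        qed (use x e(1,2) in auto)
      qed
    qed
    show "(`) ((-`) f) ` {M. perfect_matching (induced E (f ` V)) M} \<subseteq> {M. perfect_matching (induced E V) M}"
    proof safe
      fix M assume M: "perfect_matching (induced E (f ` V)) M"
      have sub: "e \<subseteq> f ` V" if "e \<in> M" for e using M that by (auto simp: perfect_matching_induced)
      show "perfect_matching (induced E V) ((-`) f ` M)"
        unfolding perfect_matching_induced
      proof (intro conjI ballI)
        show "(-`) f ` M \<subseteq> E"
        proof safe
          fix e assume "e \<in> M"
          then have "f ` (f -` e) \<in> E"
            using post[OF sub] M by (auto simp: perfect_matching_induced)
          then show "f -` e \<in> E" by (simp only: E)
        qed
        show "e \<subseteq> V" if e: "e \<in> (-`) f ` M" for e
        proof -
          obtain e' where "e = f -` e'" "e' \<subseteq> f ` V" using e sub by blast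
          then show ?thesis using pre[of V] by blast
        qed
        fix x assume "x \<in> V"
        then obtain e where e: "e \<in> M" "f x \<in> e" "\<And>e'. e' \<in> M \<Longrightarrow> f x \<in> e' \<Longrightarrow> e' = e"
          using M unfolding perfect_matching_induced by (metis imageI)
        show "\<exists>!e. e \<in> (-`) f ` M \<and> x \<in> e"
        proof (rule ex1I[of _ "f -` e"])
          fix e' assume "e' \<in> (-`) f ` M \<and> x \<in> e'"
          then show "e' = f -` e" using e(3) by auto
        qed (use e(1,2) in auto)
      qed
    qed
  qed
  from bij_betw_same_card[OF this] show ?thesis by (simp add: T_def)
qed

section \<open>Aztec rectangles\<close>

text \<open>An Aztec rectangle with movable bounds, so that peeling off a boundary row or column
  changes a single bound; \<open>block 0 m 0 m\<close> is the vertex set of the original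
  rectangle.\<close>

definition block :: "nat \<Rightarrow> nat \<Rightarrow> nat \<Rightarrow> nat \<Rightarrow> vertex set" where
  "block i0 i1 j0 j1 = {White i j | i j. i0 \<le> i \<and> i \<le> i1 \<and> j0 \<le> j \<and> j \<le> j1}
     \<union> {Black i j | i j. i0 \<le> i \<and> i < i1 \<and> j0 \<le> j \<and> j \<le> j1 + 1}"

lemma block_iff [simp]:
  "White i j \<in> block i0 i1 j0 j1 \<longleftrightarrow> i0 \<le> i \<and> i \<le> i1 \<and> j0 \<le> j \<and> j \<le> j1"
  "Black i j \<in> block i0 i1 j0 j1 \<longleftrightarrow> i0 \<le> i \<and> i < i1 \<and> j0 \<le> j \<and> j \<le> j1 + 1"
  by (auto simp: block_def)

lemma lattice_edge_iff:
  "{Black i j, White i' j'} \<in> lattice_edges \<longleftrightarrow> (i' = i \<or> i' = i + 1) \<and> (j' + 1 = j \<or> j' = j)"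
  "{White i' j', Black i j} \<in> lattice_edges \<longleftrightarrow> (i' = i \<or> i' = i + 1) \<and> (j' + 1 = j \<or> j' = j)"
  by (auto simp: lattice_edges_def doubleton_eq_iff)

lemma lattice_edgeE:
  assumes "e \<in> lattice_edges"
  obtains i j i' j' where "e = {Black i j, White i' j'}" "i' = i \<or> i' = i + 1" "j' + 1 = j \<or> j' = j"
  using assms by (auto simp: lattice_edges_def)

lemma lattice_edge_Black:
  assumes "e \<in> lattice_edges" "Black i j \<in> e"
  obtains i' j' where "e = {Black i j, White i' j'}" "i' = i \<or> i' = i + 1" "j' + 1 = j \<or> j' = j"
  using assms by (auto elim!: lattice_edgeE)

lemma lattice_edge_White:
  assumes "e \<in> lattice_edges" "White i' j' \<in> e"
  obtains i j where "e = {White i' j', Black i j}" "i' = i \<or> i' = i + 1" "j' + 1 = j \<or> j' = j"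
proof -
  obtain i j k l where "e = {Black i j, White k l}" "k = i \<or> k = i + 1" "l + 1 = j \<or> l = j"
    using assms(1) by (rule lattice_edgeE)
  with assms(2) that[of i j] show thesis by (auto simp: insert_commute)
qed

lemma aztec_vertices_block: "aztec_vertices m = block 0 m 0 m"
  by (auto simp: aztec_vertices_def block_def)

lemma finite_block: "finite (block i0 i1 j0 j1)"
proof (rule finite_subset)
  show "block i0 i1 j0 j1 \<subseteq> (\<lambda>(i, j). White i j) ` ({..i1} \<times> {..j1})
      \<union> (\<lambda>(i, j). Black i j) ` ({..i1} \<times> {..j1 + 1})"
    by (auto simp: block_def)
qed simp

text \<open>The black vertices at level \<open>j0\<close> have neighbours only in the white row
  \<open>j0\<close>, so the two form a zigzag chain that collapses once one white vertex is missing.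
  \<open>S\<close> collects deleted vertices away from the chain.\<close>

lemma T_bottom_row:
  assumes "i0 \<le> i" "i \<le> i1" "j0 \<le> j1" "\<And>k. White k j0 \<notin> S \<and> Black k j0 \<notin> S"
  shows "T (induced lattice_edges (block i0 i1 j0 j1 - insert (White i j0) S)) =
    T (induced lattice_edges (block i0 i1 (Suc j0) j1 - S))"
proof (subst T_forced_chain[where lo = i0 and hi = i1 and r = i
      and p = "\<lambda>k. White k j0" and q = "\<lambda>k. Black k j0"])
  have eq: "block i0 i1 j0 j1 - insert (White i j0) S - (\<lambda>k. White k j0) ` {i0..i1} - (\<lambda>k. Black k j0) ` {i0..<i1}
      = block i0 i1 (Suc j0) j1 - S" (is "?L = ?R")
  proof (rule set_eqI)
    show "v \<in> ?L \<longleftrightarrow> v \<in> ?R" for v using assms by (cases v) auto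
  qed
  show "T (induced lattice_edges ?L) = T (induced lattice_edges ?R)" by (simp only: eq)
  show "e = {Black t j0, White t j0} \<or> e = {Black t j0, White (Suc t) j0}"
    if "e \<in> lattice_edges" "e \<subseteq> block i0 i1 j0 j1 - insert (White i j0) S" "Black t j0 \<in> e" for t e
    using that(1,3) by (rule lattice_edge_Black) (use that(2) in auto)
qed (use assms in \<open>auto simp: lattice_edge_iff inj_on_def\<close>)

lemma T_top_row:
  assumes "i0 \<le> i" "i \<le> i1" "j0 \<le> Suc j1" "\<And>k. White k (Suc j1) \<notin> S \<and> Black k (Suc (Suc j1)) \<notin> S"
  shows "T (induced lattice_edges (block i0 i1 j0 (Suc j1) - insert (White i (Suc j1)) S)) =
    T (induced lattice_edges (block i0 i1 j0 j1 - S))"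
proof (subst T_forced_chain[where lo = i0 and hi = i1 and r = i
      and p = "\<lambda>k. White k (Suc j1)" and q = "\<lambda>k. Black k (Suc (Suc j1))"])
  have eq: "block i0 i1 j0 (Suc j1) - insert (White i (Suc j1)) S - (\<lambda>k. White k (Suc j1)) ` {i0..i1}
        - (\<lambda>k. Black k (Suc (Suc j1))) ` {i0..<i1}
      = block i0 i1 j0 j1 - S" (is "?L = ?R")
  proof (rule set_eqI)
    show "v \<in> ?L \<longleftrightarrow> v \<in> ?R" for v using assms by (cases v) auto
  qed
  show "T (induced lattice_edges ?L) = T (induced lattice_edges ?R)" by (simp only: eq)
  show "e = {Black t (Suc (Suc j1)), White t (Suc j1)} \<or> e = {Black t (Suc (Suc j1)), White (Suc t) (Suc j1)}"
    if "e \<in> lattice_edges" "e \<subseteq> block i0 i1 j0 (Suc j1) - insert (White i (Suc j1)) S" "Black t (Suc (Suc j1)) \<in> e" for t e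
    using that(1,3) by (rule lattice_edge_Black) (use that(2) in auto)
qed (use assms in \<open>auto simp: lattice_edge_iff inj_on_def\<close>)

text \<open>The colours change roles: in the outermost column each white vertex sees only the two
  black vertices next to it in the column \<open>i0\<close>, and the missing vertex of the chain is
  black.\<close>

lemma T_left_column:
  assumes "i0 < i1" "j0 \<le> j" "j \<le> Suc j1" "\<And>k. White i0 k \<notin> S \<and> Black i0 k \<notin> S"
  shows "T (induced lattice_edges (block i0 i1 j0 j1 - insert (Black i0 j) S)) =
    T (induced lattice_edges (block (Suc i0) i1 j0 j1 - S))"
proof (subst T_forced_chain[where lo = j0 and hi = "Suc j1" and r = j
      and p = "\<lambda>k. Black i0 k" and q = "\<lambda>k. White i0 k"])
  have eq: "block i0 i1 j0 j1 - insert (Black i0 j) S - (\<lambda>k. Black i0 k) ` {j0..Suc j1}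
        - (\<lambda>k. White i0 k) ` {j0..<Suc j1}
      = block (Suc i0) i1 j0 j1 - S" (is "?L = ?R")
  proof (rule set_eqI)
    show "v \<in> ?L \<longleftrightarrow> v \<in> ?R" for v using assms by (cases v) auto
  qed
  show "T (induced lattice_edges ?L) = T (induced lattice_edges ?R)" by (simp only: eq)
  show "e = {White i0 t, Black i0 t} \<or> e = {White i0 t, Black i0 (Suc t)}"
    if "e \<in> lattice_edges" "e \<subseteq> block i0 i1 j0 j1 - insert (Black i0 j) S" "White i0 t \<in> e" for t e
    using that(1,3) by (rule lattice_edge_White) (use that(2) in auto)
qed (use assms in \<open>auto simp: lattice_edge_iff inj_on_def\<close>)

lemma T_right_column:
  assumes "i0 \<le> i1" "j0 \<le> j" "j \<le> Suc j1" "\<And>k. White (Suc i1) k \<notin> S \<and> Black i1 k \<notin> S"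
  shows "T (induced lattice_edges (block i0 (Suc i1) j0 j1 - insert (Black i1 j) S)) =
    T (induced lattice_edges (block i0 i1 j0 j1 - S))"
proof (subst T_forced_chain[where lo = j0 and hi = "Suc j1" and r = j
      and p = "\<lambda>k. Black i1 k" and q = "\<lambda>k. White (Suc i1) k"])
  have eq: "block i0 (Suc i1) j0 j1 - insert (Black i1 j) S - (\<lambda>k. Black i1 k) ` {j0..Suc j1}
        - (\<lambda>k. White (Suc i1) k) ` {j0..<Suc j1}
      = block i0 i1 j0 j1 - S" (is "?L = ?R")
  proof (rule set_eqI)
    show "v \<in> ?L \<longleftrightarrow> v \<in> ?R" for v using assms by (cases v) auto
  qed
  show "T (induced lattice_edges ?L) = T (induced lattice_edges ?R)" by (simp only: eq)
  show "e = {White (Suc i1) t, Black i1 t} \<or> e = {White (Suc i1) t, Black i1 (Suc t)}"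
    if "e \<in> lattice_edges" "e \<subseteq> block i0 (Suc i1) j0 j1 - insert (Black i1 j) S" "White (Suc i1) t \<in> e" for t e
    using that(1,3) by (rule lattice_edge_White) (use that(2) in auto)
qed (use assms in \<open>auto simp: lattice_edge_iff inj_on_def\<close>)

section \<open>Translations of blocks\<close>

fun translate :: "nat \<Rightarrow> nat \<Rightarrow> vertex \<Rightarrow> vertex" where
  "translate s t (White i j) = White (i + s) (j + t)"
| "translate s t (Black i j) = Black (i + s) (j + t)"

lemma inj_translate: "inj (translate s t)"
proof (rule injI)
  fix x y assume "translate s t x = translate s t y"
  then show "x = y" by (cases x; cases y) auto
qed

lemma translate_lattice_edges: "translate s t ` e \<in> lattice_edges \<longleftrightarrow> e \<in> lattice_edges"
proof
  assume "translate s t ` e \<in> lattice_edges"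
  then obtain i j i' j' where eq: "translate s t ` e = {Black i j, White i' j'}"
    and adj: "i' = i \<or> i' = i + 1" "j' + 1 = j \<or> j' = j"
    by (rule lattice_edgeE)
  have "Black i j \<in> translate s t ` e" "White i' j' \<in> translate s t ` e"
    unfolding eq by simp_all
  then obtain x y where x: "x \<in> e" "translate s t x = Black i j"
    and y: "y \<in> e" "translate s t y = White i' j'"
    by (metis imageE)
  obtain k l where xk: "x = Black k l" "i = k + s" "j = l + t" using x(2) by (cases x) auto
  obtain k' l' where yk: "y = White k' l'" "i' = k' + s" "j' = l' + t" using y(2) by (cases y) auto
  have "translate s t ` e = translate s t ` {x, y}" unfolding eq using x(2) y(2) by simp
  then have "e = {x, y}" by (rule inj_image_eq_iff[OF inj_translate, THEN iffD1])
  then show "e \<in> lattice_edges" using xk yk adj by (simp add: lattice_edge_iff)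
next
  assume "e \<in> lattice_edges"
  then show "translate s t ` e \<in> lattice_edges"
    by (rule lattice_edgeE) (simp add: lattice_edge_iff)
qed

lemma translate_block: "translate s t ` block i0 i1 j0 j1 = block (i0 + s) (i1 + s) (j0 + t) (j1 + t)"
proof (rule set_eqI)
  fix v
  show "v \<in> translate s t ` block i0 i1 j0 j1 \<longleftrightarrow> v \<in> block (i0 + s) (i1 + s) (j0 + t) (j1 + t)"
  proof
    assume "v \<in> translate s t ` block i0 i1 j0 j1"
    then obtain u where "u \<in> block i0 i1 j0 j1" "v = translate s t u" by blast
    then show "v \<in> block (i0 + s) (i1 + s) (j0 + t) (j1 + t)" by (cases u) auto
  next
    assume v: "v \<in> block (i0 + s) (i1 + s) (j0 + t) (j1 + t)"
    show "v \<in> translate s t ` block i0 i1 j0 j1"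
    proof (cases v)
      case (White i j)
      with v show ?thesis by (intro image_eqI[of _ _ "White (i - s) (j - t)"]) auto
    next
      case (Black i j)
      with v show ?thesis by (intro image_eqI[of _ _ "Black (i - s) (j - t)"]) auto
    qed
  qed
qed

lemma holey_aztec_induced:
  "holey_aztec m a b = induced lattice_edges (block 0 m 0 m - {White b a})"
proof -
  have "aztec_edges m = {e \<in> lattice_edges. e \<subseteq> block 0 m 0 m}"
  proof (intro equalityI subsetI)
    show "e \<in> {e \<in> lattice_edges. e \<subseteq> block 0 m 0 m}" if "e \<in> aztec_edges m" for e
      using that by (auto simp: aztec_edges_def lattice_edge_iff)
    fix e assume "e \<in> {e \<in> lattice_edges. e \<subseteq> block 0 m 0 m}"
    then have e: "e \<in> lattice_edges" "e \<subseteq> block 0 m 0 m" by auto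
    from e(1) obtain i j i' j' where
      "e = {Black i j, White i' j'}" "i' = i \<or> i' = i + 1" "j' + 1 = j \<or> j' = j"
      by (rule lattice_edgeE)
    moreover from this e(2) have "i < m" "j \<le> m + 1" "i' \<le> m" "j' \<le> m" by auto
    ultimately show "e \<in> aztec_edges m"
      unfolding aztec_edges_def mem_Collect_eq by (intro exI conjI) assumption+
  qed
  moreover have "{e \<in> {e \<in> E. e \<subseteq> V}. x \<notin> e} = {e \<in> E. e \<subseteq> V - {x}}" for E V and x :: vertex
    by auto
  ultimately show ?thesis
    by (simp add: holey_aztec_def delete_vertex_def aztec_rectangle_def aztec_vertices_block induced_def)
qed

text \<open>Identifies a shifted block with a rectangle based at the origin: the hole keeps its
  place in the lattice, while its label drops by the offset of the block.\<close>

lemma T_holey_aztec: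
  "T (holey_aztec m a b) =
     T (induced lattice_edges (block s (m + s) t (m + t) - {White (b + s) (a + t)}))"
proof -
  have eq: "block s (m + s) t (m + t) - {White (b + s) (a + t)}
      = translate s t ` (block 0 m 0 m - {White b a})"
    by (simp add: image_set_diff[OF inj_translate] translate_block)
  show ?thesis
    unfolding holey_aztec_induced eq by (rule T_image[OF inj_translate translate_lattice_edges, symmetric])
qed

text \<open>Makes the division legitimate. One matched edge at a corner deletes a white vertex of a
  boundary row and a black vertex of a boundary column; both collapse, and a block smaller by one
  remains, to which induction applies.\<close>

lemma T_holey_block_nonzero:
  assumes "i0 \<le> b" "b \<le> i0 + m" "j0 \<le> a" "a \<le> j0 + m"
  shows "T (induced lattice_edges (block i0 (i0 + m) j0 (j0 + m) - {White b a})) \<noteq> 0"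
  using assms
proof (induction m arbitrary: i0 j0)
  case 0
  then have empty: "block i0 (i0 + 0) j0 (j0 + 0) - {White b a} = {}"
    by (auto simp: block_def)
  have "{M. perfect_matching (induced lattice_edges {}) M} = {{}}"
    by (auto simp: perfect_matching_induced lattice_edges_def)
  then show ?case unfolding empty T_def by simp
next
  case (Suc m)
  let ?h = "White b a" and ?B = "block i0 (Suc (i0 + m)) j0 (Suc (j0 + m))"
  have extend: "T (induced lattice_edges (?B - {?h})) \<noteq> 0"
    if "T (induced lattice_edges (?B - {White i j, Black i' j', ?h})) \<noteq> 0"
      and "{Black i' j', White i j} \<in> lattice_edges" "White i j \<in> ?B" "Black i' j' \<in> ?B"
      and "White i j \<noteq> ?h" for i j i' j'
  proof (rule T_nonzero_extend[OF _ that(2)])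
    have "?B - {?h} - {Black i' j', White i j} = ?B - {White i j, Black i' j', ?h}" by auto
    then show "T (induced lattice_edges (?B - {?h} - {Black i' j', White i j})) \<noteq> 0"
      using that(1) by simp
  qed (use that finite_block in auto)
  \<comment> \<open>The corner is chosen so that the hole lies neither in the row nor in the column
    that collapses, hence in the remaining block.\<close>
  consider "j0 < a" "i0 < b" | "j0 < a" "i0 = b" | "j0 = a" "i0 < b" | "j0 = a" "i0 = b"
    using Suc.prems by linarith
  then have "T (induced lattice_edges (?B - {?h})) \<noteq> 0"
  proof cases
    case 1
    show ?thesis
      by (rule extend[of i0 j0 i0 "Suc j0"])
        (use 1 Suc.prems Suc.IH[of "Suc i0" "Suc j0"] in
          \<open>simp_all add: T_bottom_row T_left_column lattice_edge_iff\<close>)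
  next
    case 2
    show ?thesis
      by (rule extend[of "Suc (i0 + m)" j0 "i0 + m" "Suc j0"])
        (use 2 Suc.prems Suc.IH[of i0 "Suc j0"] in
          \<open>simp_all add: T_bottom_row T_right_column lattice_edge_iff\<close>)
  next
    case 3
    show ?thesis
      by (rule extend[of i0 "Suc (j0 + m)" i0 "Suc (j0 + m)"])
        (use 3 Suc.prems Suc.IH[of "Suc i0" j0] in
          \<open>simp_all add: T_top_row T_left_column lattice_edge_iff\<close>)
  next
    case 4
    show ?thesis
      by (rule extend[of "Suc (i0 + m)" "Suc (j0 + m)" "i0 + m" "Suc (j0 + m)"])
        (use 4 Suc.prems Suc.IH[of i0 j0] in
          \<open>simp_all add: T_top_row T_right_column lattice_edge_iff\<close>)
  qed
  then show ?case by simp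
qed

lemma T_holey_aztec_nonzero: "\<lbrakk>a \<le> m; b \<le> m\<rbrakk> \<Longrightarrow> T (holey_aztec m a b) \<noteq> 0"
  using T_holey_block_nonzero[of 0 b m 0 a] by (simp add: holey_aztec_induced)

section \<open>The recurrence for holey rectangles\<close>

fun is_white :: "vertex \<Rightarrow> bool" where
  "is_white (White i j) = True"
| "is_white (Black i j) = False"

text \<open>Deleting \<open>White 0 0\<close> peels off the bottom row, \<open>White 0 ?n\<close>
  the top row, \<open>Black 0 1\<close> the left column and \<open>Black (Suc k) 1\<close> the right
  one. The label \<open>a\<close> drops by one exactly when the bottom row goes, and
  \<open>b\<close> exactly when the left column goes.\<close>

lemma holey_aztec_recurrence:
  assumes "1 \<le> a" "a \<le> Suc k" "1 \<le> b" "b \<le> Suc k"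
  shows "T (holey_aztec (k + 2) a b) * T (holey_aztec k (a - 1) (b - 1)) =
    T (holey_aztec (k + 1) (a - 1) (b - 1)) * T (holey_aztec (k + 1) a b)
    + T (holey_aztec (k + 1) (a - 1) b) * T (holey_aztec (k + 1) a (b - 1))"
proof -
  let ?n = "Suc (Suc k)" and ?h = "White b a"
  let ?B = "block 0 ?n 0 ?n"
  let ?T = "\<lambda>V. T (induced lattice_edges V)"
  \<comment> \<open>The black corners sit at ordinate 1, not 0, so that they survive the collapse of
    the bottom or the top row and can trigger that of their column.\<close>
  interpret condensation lattice_edges "?B - {?h}" is_white "White 0 0" "Black 0 1" "White 0 ?n" "Black (Suc k) 1"
  proof
    show "\<exists>x y. e = {x, y} \<and> is_white x \<and> \<not> is_white y" if "e \<in> lattice_edges" for e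
      using that by (rule lattice_edgeE) (metis insert_commute is_white.simps)
    fix A B
    assume "A \<subseteq> ?B - {?h}" "B \<subseteq> ?B - {?h}" "A \<inter> B = {}"
      "(White 0 0, White 0 ?n) \<in> (edges_within lattice_edges A)\<^sup>*"
      "(Black 0 1, Black (Suc k) 1) \<in> (edges_within lattice_edges B)\<^sup>*"
    then show False
      using lattice_crossing[of A ?n B 0 0 1 1] by (auto simp: aztec_vertices_block)
  qed (use assms finite_block in auto)
  have diff: "?B - {?h} - X = ?B - insert ?h X" for X by auto
  have ab: "?T (?B - {?h} - {White 0 0, Black 0 1}) = T (holey_aztec (k + 1) (a - 1) (b - 1))"
    using assms T_bottom_row[of 0 0 ?n 0 ?n "{Black 0 1, ?h}"] T_left_column[of 0 ?n 1 1 ?n "{?h}"]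
      T_holey_aztec[of "k + 1" "a - 1" "b - 1" 1 1]
    by (simp add: diff insert_commute)
  have cd: "?T (?B - {?h} - {White 0 ?n, Black (Suc k) 1}) = T (holey_aztec (k + 1) a b)"
    using assms T_top_row[of 0 0 ?n 0 "Suc k" "{Black (Suc k) 1, ?h}"]
      T_right_column[of 0 "Suc k" 0 1 "Suc k" "{?h}"] T_holey_aztec[of "k + 1" a b 0 0]
    by (simp add: diff insert_commute)
  have ad: "?T (?B - {?h} - {White 0 0, Black (Suc k) 1}) = T (holey_aztec (k + 1) (a - 1) b)"
    using assms T_bottom_row[of 0 0 ?n 0 ?n "{Black (Suc k) 1, ?h}"]
      T_right_column[of 0 "Suc k" 1 1 ?n "{?h}"] T_holey_aztec[of "k + 1" "a - 1" b 0 1]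
    by (simp add: diff insert_commute)
  have bc: "?T (?B - {?h} - {Black 0 1, White 0 ?n}) = T (holey_aztec (k + 1) a (b - 1))"
    using assms T_top_row[of 0 0 ?n 0 "Suc k" "{Black 0 1, ?h}"]
      T_left_column[of 0 ?n 0 1 "Suc k" "{?h}"] T_holey_aztec[of "k + 1" a "b - 1" 1 0]
    by (simp add: diff insert_commute)
  have abcd: "?T (?B - {?h} - {White 0 0, Black 0 1, White 0 ?n, Black (Suc k) 1})
      = T (holey_aztec k (a - 1) (b - 1))"
    using assms T_bottom_row[of 0 0 ?n 0 ?n "{White 0 ?n, Black 0 1, Black (Suc k) 1, ?h}"]
      T_top_row[of 0 0 ?n 1 "Suc k" "{Black 0 1, Black (Suc k) 1, ?h}"]
      T_left_column[of 0 ?n 1 1 "Suc k" "{Black (Suc k) 1, ?h}"]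
      T_right_column[of 1 "Suc k" 1 1 "Suc k" "{?h}"] T_holey_aztec[of k "a - 1" "b - 1" 1 1]
    by (simp add: diff insert_commute)
  show ?thesis
    using graphical_condensation unfolding ab cd ad bc abcd
    by (simp add: holey_aztec_induced)
qed

theorem theorem4p1:
  fixes n a b :: nat
  assumes "n \<ge> 2"
    and "1 \<le> a" and "a \<le> n - 1"
    and "1 \<le> b" and "b \<le> n - 1"
  shows "T (holey_aztec (n - 2) (a - 1) (b - 1)) \<noteq> 0 \<and>
    real (T (holey_aztec n a b)) =
      (real (T (holey_aztec (n - 1) a (b - 1))) * real (T (holey_aztec (n - 1) (a - 1) b))
        + real (T (holey_aztec (n - 1) a b)) * real (T (holey_aztec (n - 1) (a - 1) (b - 1))))
      / real (T (holey_aztec (n - 2) (a - 1) (b - 1)))"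
proof -
  define k where "k = n - 2"
  have k: "n = k + 2" "n - 1 = k + 1" "n - 2 = k" using assms(1) by (simp_all add: k_def)
  have nz: "T (holey_aztec k (a - 1) (b - 1)) \<noteq> 0"
    by (rule T_holey_aztec_nonzero) (use assms k in auto)
  have "T (holey_aztec (k + 2) a b) * T (holey_aztec k (a - 1) (b - 1)) =
    T (holey_aztec (k + 1) (a - 1) (b - 1)) * T (holey_aztec (k + 1) a b)
    + T (holey_aztec (k + 1) (a - 1) b) * T (holey_aztec (k + 1) a (b - 1))"
    by (rule holey_aztec_recurrence) (use assms k in auto)
  from arg_cong[OF this, of real] nz show ?thesis
    unfolding k by (simp add: field_simps)
qed

end
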